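(* Let $g:\mathbb{R}^+\to\mathbb{R}^+$ be a function satisfying $$\lim_{x\to\infty}\frac{g(x+w)}{g(x)}=1\qquad\text{for all } w>0.$$ If $f:\mathbb{R}^+\to\mathbb{R}^+$ is an eventually $\log$-convex (or eventually $\log$-concave) function of order two satisfying $f(x+1)=g(x)f(x)$ for all $x>0$ and $f(1)=1$, then $f$ is uniquely determined by $g$ through the equation $$f(x)=\lim_{n\to\infty}\frac{g(n)\cdots g(1)\,g(n)^x}{g(n+x)\,g(n+x-1)\cdots g(x)}\qquad\text{for all } x>0,$$ that is, for every $x>0$ the limit exists and equals $f(x)$.
   Context: $\mathbb{R}^+=(0,\infty)$. For a real function $h$ on an interval $I$ and points $x_0<x_1<\cdots$ of $I$, the divided differences are defined by $[x_0;h]=h(x_0)$ and $[x_0,\dots,x_k;h]=\frac{[x_1,\dots,x_k;h]-[x_0,\dots,x_{k-1};h]}{x_k-x_0}$ for $k\ge1$. The function $h$ is convex of order two on $I$ if $[x_0,x_1,x_2,x_3;h]\ge 0$ for all $x_0<x_1<x_2<x_3$ in $I$, and concave of order two if $-h$ is convex of order two. A function $f:\mathbb{R}^+\to\mathbb{R}^+$ is eventually $\log$-convex (resp. $\log$-concave) of order two if there is a number $M$ such that $\log f$ is convex (resp. concave) of order two on $(M,\infty)$. In the limit formula the numerator is $g(n)^x\prod_{k=1}^n g(k)$ and the denominator is $\prod_{k=0}^{n} g(x+k)$, with $n$ ranging over positive integers. *)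

theory Defs
  imports "HOL-Analysis.Analysis"
begin

text \<open>\<open>divided_diff h [x0, \<dots>, xk]\<close> is the divided difference of \<open>h\<close> at \<open>x0, \<dots>, xk\<close>; the empty list is a junk case.\<close>

function divided_diff :: "(real \<Rightarrow> real) \<Rightarrow> real list \<Rightarrow> real" where
  "divided_diff h [] = 0"
| "divided_diff h [x] = h x"
| "divided_diff h (x # y # ys) =
     (divided_diff h (y # ys) - divided_diff h (x # butlast (y # ys))) / (last (y # ys) - x)"
  by pat_completeness auto
termination by (relation "Wellfounded.measure (\<lambda>(h, xs). length xs)") auto

definition convex_order_two_on :: "real set \<Rightarrow> (real \<Rightarrow> real) \<Rightarrow> bool" where
  "convex_order_two_on I h \<longleftrightarrow>
     (\<forall>x0\<in>I. \<forall>x1\<in>I. \<forall>x2\<in>I. \<forall>x3\<in>I.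
        x0 < x1 \<and> x1 < x2 \<and> x2 < x3 \<longrightarrow> divided_diff h [x0, x1, x2, x3] \<ge> 0)"

definition concave_order_two_on :: "real set \<Rightarrow> (real \<Rightarrow> real) \<Rightarrow> bool" where
  "concave_order_two_on I h \<longleftrightarrow> convex_order_two_on I (\<lambda>x. - h x)"

text \<open>The requirement \<open>M \<ge> 0\<close> only keeps the ray inside the positive reals, the domain of
  the functions considered; it is no restriction, as \<open>M\<close> may always be enlarged.\<close>

definition eventually_log_convex_order_two :: "(real \<Rightarrow> real) \<Rightarrow> bool" where
  "eventually_log_convex_order_two f \<longleftrightarrow>
     (\<exists>M\<ge>0. convex_order_two_on {M<..} (\<lambda>x. ln (f x)))"

definition eventually_log_concave_order_two :: "(real \<Rightarrow> real) \<Rightarrow> bool" where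
  "eventually_log_concave_order_two f \<longleftrightarrow>
     (\<exists>M\<ge>0. concave_order_two_on {M<..} (\<lambda>x. ln (f x)))"

end

theory Submission
  imports Defs
begin

text \<open>Put \<open>h = ln \<circ> f\<close>, so that \<open>h (y + 1) - h y = ln (g y)\<close>. The \<open>n\<close>-th term of the sequence is
  \<open>f x * g n powr x * f (n + 1) / f (n + 1 + x)\<close>, hence it suffices that the error
  \<open>h (y + x) - h y - x * (h (y + 1) - h y)\<close> of linear extrapolation tends to \<open>0\<close> as
  \<open>y \<rightarrow> \<infinity>\<close>. For \<open>0 < x < 1\<close> the error is \<open>x * (x - 1)\<close> times the second divided difference at
  \<open>y, y + x, y + 1\<close>. By convexity of order two this lies between those at \<open>y - 1, y, y + 1\<close> and at
  \<open>y, y + 1, y + 2\<close>, which are halves of differences of \<open>ln \<circ> g\<close> and so vanish in the limit.\<close>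

text \<open>Symmetric form of the third divided difference: each value is divided by the product of
  the differences of its node from the other nodes. In terms of the gaps \<open>a\<close>,
  \<open>b\<close>, \<open>c\<close> all denominators are visibly nonzero, so the claim becomes a
  polynomial identity.\<close>

lemma divided_diff_4:
  assumes "x0 < x1" "x1 < x2" "x2 < x3"
  shows "divided_diff h [x0, x1, x2, x3] =
    h x0 / ((x0 - x1) * (x0 - x2) * (x0 - x3)) + h x1 / ((x1 - x0) * (x1 - x2) * (x1 - x3)) +
    h x2 / ((x2 - x0) * (x2 - x1) * (x2 - x3)) + h x3 / ((x3 - x0) * (x3 - x1) * (x3 - x2))"
proof -
  define a b c where "a = x1 - x0" and "b = x2 - x1" and "c = x3 - x2"
  have pos: "a > 0" "b > 0" "c > 0" using assms by (auto simp: a_def b_def c_def)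
  have x: "x1 = x0 + a" "x2 = x0 + a + b" "x3 = x0 + a + b + c"
    by (auto simp: a_def b_def c_def)
  have nz: "a \<noteq> 0" "b \<noteq> 0" "c \<noteq> 0" "a + b \<noteq> 0" "b + c \<noteq> 0" "a + b + c \<noteq> 0" "a + (b + c) \<noteq> 0"
    using pos by auto
  define p q r s where "p = h x0" and "q = h x1" and "r = h x2" and "s = h x3"
  have "(((s - r) / c - (r - q) / b) / (b + c) - ((r - q) / b - (q - p) / a) / (a + b)) / (a + b + c)
     = - p / (a * (a + b) * (a + b + c)) + q / (a * b * (b + c)) - r / ((a + b) * b * c)
       + s / ((a + b + c) * (b + c) * c)"
    using nz by (simp add: divide_simps) algebra
  moreover have "divided_diff h [x0, x1, x2, x3] =
    (((s - r) / c - (r - q) / b) / (b + c) - ((r - q) / b - (q - p) / a) / (a + b)) / (a + b + c)"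
    by (simp add: p_def q_def r_def s_def a_def b_def c_def)
  moreover have
    "(x0 - x1) * (x0 - x2) * (x0 - x3) = - (a * (a + b) * (a + b + c))"
    "(x1 - x0) * (x1 - x2) * (x1 - x3) = a * b * (b + c)"
    "(x2 - x0) * (x2 - x1) * (x2 - x3) = - ((a + b) * b * c)"
    "(x3 - x0) * (x3 - x1) * (x3 - x2) = (a + b + c) * (b + c) * c"
    unfolding x by algebra+
  ultimately show ?thesis
    by (simp add: p_def q_def r_def s_def)
qed

text \<open>Both divided differences used below are linear in \<open>h (y + r)\<close>. Its
  coefficient is negative when \<open>y + r\<close> is the third node and positive when it is the
  second, so solving for it gives an upper and a lower bound. The condition \<open>y > M + 1\<close>
  keeps the node \<open>y - 1\<close> in the ray.\<close>

lemma convex_order_two_extrapolation_bounds: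
  assumes conv: "convex_order_two_on {M<..} h" and y: "y > M + 1" and r: "0 < r" "r < 1"
  defines "D \<equiv> h (y + r) - h y - r * (h (y + 1) - h y)"
  shows "D \<le> - (r * (1 - r) / 2) * ((h (y + 1) - h y) - (h y - h (y - 1)))"
    and "D \<ge> - (r * (1 - r) / 2) * ((h (y + 1 + 1) - h (y + 1)) - (h (y + 1) - h y))"
proof -
  have "divided_diff h [y - 1, y, y + r, y + 1] \<ge> 0"
    using conv y r unfolding convex_order_two_on_def by (auto simp del: divided_diff.simps)
  hence "h (y - 1) / - (2 * (1 + r)) + h y / r + h (y + r) / - (r * (1 - r) * (1 + r))
      + h (y + 1) / (2 * (1 - r)) \<ge> 0"
    using r by (subst (asm) divided_diff_4) (auto simp: algebra_simps)
  \<comment> \<open>This positive factor turns the coefficient of \<open>h (y + r)\<close> into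
    -1.\<close>
  hence "r * (1 - r) * (1 + r) * (h (y - 1) / - (2 * (1 + r)) + h y / r
      + h (y + r) / - (r * (1 - r) * (1 + r)) + h (y + 1) / (2 * (1 - r))) \<ge> 0"
    using r by (intro mult_nonneg_nonneg) auto
  also have "r * (1 - r) * (1 + r) * (h (y - 1) / - (2 * (1 + r)) + h y / r
      + h (y + r) / - (r * (1 - r) * (1 + r)) + h (y + 1) / (2 * (1 - r)))
    = - (r * (1 - r) / 2) * h (y - 1) + (1 - r) * (1 + r) * h y - h (y + r)
      + r * (1 + r) / 2 * h (y + 1)"
  proof -
    have "1 + r \<noteq> 0" "1 - r \<noteq> 0" "r \<noteq> 0" using r by auto
    thus ?thesis by (simp add: divide_simps) algebra
  qed
  finally show "D \<le> - (r * (1 - r) / 2) * ((h (y + 1) - h y) - (h y - h (y - 1)))"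
    unfolding D_def by (simp add: field_simps)
next
  have "divided_diff h [y, y + r, y + 1, y + 1 + 1] \<ge> 0"
    using conv y r unfolding convex_order_two_on_def by (auto simp del: divided_diff.simps)
  hence "h y / - (2 * r) + h (y + r) / (r * (1 - r) * (2 - r)) + h (y + 1) / - (1 - r)
      + h (y + 1 + 1) / (2 * (2 - r)) \<ge> 0"
    using r by (subst (asm) divided_diff_4) (auto simp: algebra_simps)
  \<comment> \<open>Here the factor makes that coefficient +1.\<close>
  hence "r * (1 - r) * (2 - r) * (h y / - (2 * r) + h (y + r) / (r * (1 - r) * (2 - r))
      + h (y + 1) / - (1 - r) + h (y + 1 + 1) / (2 * (2 - r))) \<ge> 0"
    using r by (intro mult_nonneg_nonneg) auto
  also have "r * (1 - r) * (2 - r) * (h y / - (2 * r) + h (y + r) / (r * (1 - r) * (2 - r))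
      + h (y + 1) / - (1 - r) + h (y + 1 + 1) / (2 * (2 - r)))
    = - ((1 - r) * (2 - r) / 2) * h y + h (y + r) - r * (2 - r) * h (y + 1)
      + r * (1 - r) / 2 * h (y + 1 + 1)"
  proof -
    \<comment> \<open>\<open>t\<close> and \<open>s\<close> stand for \<open>1 - r\<close> and
      \<open>2 - r\<close>, the other letters for values of \<open>h\<close>.\<close>
    have "r * t * s * (a / - (2 * r) + b / (r * t * s) + c / - t + d / (2 * s))
        = - (t * s / 2) * a + b - r * s * c + r * t / 2 * d"
      if "t \<noteq> 0" "s \<noteq> 0" for t s a b c d :: real
      using that r by (simp add: field_simps)
    moreover have "1 - r \<noteq> 0" "2 - r \<noteq> 0" using r by auto
    ultimately show ?thesis by this
  qed
  finally show "D \<ge> - (r * (1 - r) / 2) * ((h (y + 1 + 1) - h (y + 1)) - (h (y + 1) - h y))"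
    unfolding D_def by (simp add: field_simps)
qed

text \<open>For \<open>0 < x < 1\<close> the two bounds squeeze the error. Raising \<open>x\<close>
  by 1 changes the error by exactly the expression in \<open>lim\<close> with \<open>w = x\<close>,
  so induction on the integer part covers all larger \<open>x\<close>.\<close>

lemma convex_order_two_extrapolation_tendsto_0:
  fixes h :: "real \<Rightarrow> real"
  assumes conv: "convex_order_two_on {M<..} h"
    and lim: "\<And>w. w > 0 \<Longrightarrow>
      ((\<lambda>y. (h (y + w + 1) - h (y + w)) - (h (y + 1) - h y)) \<longlongrightarrow> 0) at_top"
    and x: "x \<ge> 0"
  shows "((\<lambda>y. h (y + x) - h y - x * (h (y + 1) - h y)) \<longlongrightarrow> 0) at_top"
proof -
  have frac: "((\<lambda>y. h (y + r) - h y - r * (h (y + 1) - h y)) \<longlongrightarrow> 0) at_top" (is "(?D \<longlongrightarrow> 0) _")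
    if r: "0 < r" "r < 1" for r
  proof (rule tendsto_sandwich)
    let ?c = "- (r * (1 - r) / 2)"
    let ?U = "\<lambda>y. ?c * ((h (y + 1) - h y) - (h y - h (y - 1)))"
    let ?L = "\<lambda>y. ?c * ((h (y + 1 + 1) - h (y + 1)) - (h (y + 1) - h y))"
    show "\<forall>\<^sub>F y in at_top. ?L y \<le> ?D y" "\<forall>\<^sub>F y in at_top. ?D y \<le> ?U y"
      using eventually_gt_at_top[of "M + 1"]
      by (eventually_elim, use convex_order_two_extrapolation_bounds[OF conv] r in blast)+
    have L: "(?L \<longlongrightarrow> ?c * 0) at_top"
      by (intro tendsto_mult tendsto_const lim) simp
    thus "(?L \<longlongrightarrow> 0) at_top" by simp
    \<comment> \<open>The upper bound at \<open>y\<close> is the lower bound at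
      \<open>y - 1\<close>, so both have the same limit.\<close>
    have "filterlim (\<lambda>y::real. y + (-1)) at_top at_top"
      using filterlim_tendsto_add_at_top[OF tendsto_const filterlim_ident, of "-1"]
      by (simp add: add.commute)
    hence "((\<lambda>y. ?L (y + (-1))) \<longlongrightarrow> ?c * 0) at_top"
      by (rule filterlim_compose[OF L])
    thus "(?U \<longlongrightarrow> 0) at_top" by simp
  qed
  have shift: "((\<lambda>y. h (y + (r + real n)) - h y - (r + real n) * (h (y + 1) - h y)) \<longlongrightarrow> 0) at_top"
    if r: "0 \<le> r" "r < 1" for r n
  proof (induction n)
    case 0
    show ?case
      using frac[of r] r by (cases "r = 0") auto
  next
    case (Suc n)
    define w where "w = r + real n"
    have step: "((\<lambda>y. (h (y + w + 1) - h (y + w)) - (h (y + 1) - h y)) \<longlongrightarrow> 0) at_top"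
      \<comment> \<open>For \<open>w = 0\<close>, which \<open>lim\<close> does not cover, the
        expression is identically 0.\<close>
      using lim[of w] r by (cases "w = 0") (auto simp: w_def)
    show ?case
      using tendsto_add[OF Suc[folded w_def] step]
      by (simp add: w_def algebra_simps)
  qed
  have "0 \<le> frac x" "frac x < 1" by (auto simp: frac_ge_0 frac_lt_1)
  from shift[OF this, of "nat \<lfloor>x\<rfloor>"] show ?thesis
    using x by (simp add: frac_def)
qed

theorem theorem3p1:
  fixes f g :: "real \<Rightarrow> real"
  assumes "\<And>x. x > 0 \<Longrightarrow> g x > 0"
    and "\<And>w. w > 0 \<Longrightarrow> ((\<lambda>x. g (x + w) / g x) \<longlongrightarrow> 1) at_top"
    and "\<And>x. x > 0 \<Longrightarrow> f x > 0"
    and "eventually_log_convex_order_two f \<or> eventually_log_concave_order_two f"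
    and "\<And>x. x > 0 \<Longrightarrow> f (x + 1) = g x * f x"
    and "f 1 = 1"
  shows "\<forall>x>0. (\<lambda>n. g (real n) powr x * (\<Prod>k=1..n. g (real k)) / (\<Prod>k=0..n. g (x + real k)))
                 \<longlonglongrightarrow> f x"
proof (intro allI impI)
  fix x :: real
  assume x: "x > 0"
  define h where "h y = ln (f y)" for y
  have diff: "h (y + 1) - h y = ln (g y)" if "y > 0" for y
    using assms(1,3)[OF that] assms(5)[OF that] by (simp add: h_def ln_mult_pos)
  have lng: "((\<lambda>y. ln (g (y + w)) - ln (g y)) \<longlongrightarrow> 0) at_top" if "w > 0" for w
  proof -
    have "((\<lambda>y. ln (g (y + w) / g y)) \<longlongrightarrow> ln 1) at_top"
      by (intro tendsto_ln assms(2) that) simp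
    moreover have "\<forall>\<^sub>F y in at_top. ln (g (y + w) / g y) = ln (g (y + w)) - ln (g y)"
      using eventually_gt_at_top[of 0]
      by eventually_elim (use assms(1) that in \<open>simp add: ln_divide_pos add_pos_pos\<close>)
    ultimately show ?thesis
      by (simp add: tendsto_cong)
  qed
  have lim: "((\<lambda>y. (h (y + w + 1) - h (y + w)) - (h (y + 1) - h y)) \<longlongrightarrow> 0) at_top"
    if "w > 0" for w
  proof -
    have "\<forall>\<^sub>F y in at_top. (h (y + w + 1) - h (y + w)) - (h (y + 1) - h y) = ln (g (y + w)) - ln (g y)"
      using eventually_gt_at_top[of 0]
      by eventually_elim (use diff that in simp)
    thus ?thesis
      using lng[OF that] by (simp add: tendsto_cong)
  qed
  have extrapolation: "((\<lambda>y. h (y + x) - h y - x * (h (y + 1) - h y)) \<longlongrightarrow> 0) at_top"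
    using assms(4)
  proof
    assume "eventually_log_convex_order_two f"
    then obtain M where "convex_order_two_on {M<..} h"
      unfolding eventually_log_convex_order_two_def h_def by blast
    from convex_order_two_extrapolation_tendsto_0[OF this lim] x show ?thesis by simp
  next
    assume "eventually_log_concave_order_two f"
    then obtain M where conv: "convex_order_two_on {M<..} (\<lambda>y. - h y)"
      unfolding eventually_log_concave_order_two_def concave_order_two_on_def h_def by blast
    \<comment> \<open>The error is linear in \<open>h\<close>, so the convex case applied to
      \<open>- h\<close> suffices.\<close>
    have "((\<lambda>y. - h (y + x) - - h y - x * (- h (y + 1) - - h y)) \<longlongrightarrow> 0) at_top"
      using x tendsto_minus[OF lim]
      by (intro convex_order_two_extrapolation_tendsto_0[OF conv]) (simp_all add: algebra_simps)
    from tendsto_minus[OF this] show ?thesis by (simp add: algebra_simps)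
  qed
  have prod_num: "(\<Prod>k=1..n. g (real k)) = f (real n + 1)" for n
    by (induction n) (use assms(5)[of "real (Suc _)"] assms(6) in \<open>simp_all add: algebra_simps\<close>)
  \<comment> \<open>Both products telescope: the numerator starts from \<open>f 1 = 1\<close>, while
    the denominator has one factor more and starts from \<open>f x\<close>.\<close>
  have prod_den: "(\<Prod>k=0..n. g (x + real k)) = f (x + real n + 1) / f x" for n
  proof (induction n)
    case 0
    show ?case using assms(3)[OF x] assms(5)[OF x] by simp
  next
    case (Suc n)
    have "f (x + real n + 1 + 1) = g (x + real n + 1) * f (x + real n + 1)"
      using x by (intro assms(5)) simp
    with Suc show ?case by (simp add: algebra_simps)
  qed
  \<comment> \<open>At \<open>y = n\<close> this is the logarithm of the \<open>n\<close>-th term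
    divided by \<open>f x\<close>. The extrapolation error at \<open>y + 1\<close> involves
    \<open>ln (g (y + 1))\<close> instead of \<open>ln (g y)\<close>; the discrepancy vanishes in
    the limit by \<open>lng\<close>.\<close>
  define E where "E y = x * ln (g y) + h (y + 1) - h (y + 1 + x)" for y
  have "(E \<longlongrightarrow> 0) at_top"
  proof -
    have "filterlim (\<lambda>y::real. y + 1) at_top at_top"
      using filterlim_tendsto_add_at_top[OF tendsto_const filterlim_ident, of 1]
      by (simp add: add.commute)
    from filterlim_compose[OF extrapolation this]
    have "((\<lambda>y. h (y + 1 + x) - h (y + 1) - x * (h (y + 1 + 1) - h (y + 1))) \<longlongrightarrow> 0) at_top" .
    hence "((\<lambda>y. - (h (y + 1 + x) - h (y + 1) - x * (h (y + 1 + 1) - h (y + 1)))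
        - x * (ln (g (y + 1)) - ln (g y))) \<longlongrightarrow> - 0 - x * 0) at_top"
      by (intro tendsto_intros lng) simp_all
    moreover have "\<forall>\<^sub>F y in at_top. - (h (y + 1 + x) - h (y + 1) - x * (h (y + 1 + 1) - h (y + 1)))
        - x * (ln (g (y + 1)) - ln (g y)) = E y"
      using eventually_gt_at_top[of 0]
      by eventually_elim (simp add: diff[symmetric] E_def algebra_simps)
    ultimately show ?thesis
      by (simp add: tendsto_cong)
  qed
  hence "(\<lambda>n. E (real n)) \<longlonglongrightarrow> 0"
    by (rule filterlim_compose[OF _ filterlim_real_sequentially])
  hence "(\<lambda>n. f x * exp (E (real n))) \<longlonglongrightarrow> f x * exp 0"
    by (intro tendsto_intros)
  \<comment> \<open>The index 0 is left out because nothing is assumed about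
    \<open>g 0\<close>.\<close>
  moreover have "\<forall>\<^sub>F n in sequentially. f x * exp (E (real n)) =
      g (real n) powr x * (\<Prod>k=1..n. g (real k)) / (\<Prod>k=0..n. g (x + real k))"
    using eventually_gt_at_top[of 0]
  proof eventually_elim
    case (elim n)
    have "g (real n) > 0" "f (real n + 1) > 0" "f (real n + 1 + x) > 0"
      using assms(1)[of "real n"] assms(3)[of "real n + 1"] assms(3)[of "real n + 1 + x"] x elim
      by auto
    hence "exp (E (real n)) = g (real n) powr x * f (real n + 1) / f (real n + 1 + x)"
      by (simp add: E_def h_def exp_add exp_diff powr_def)
    thus ?case
      unfolding prod_num prod_den by (simp add: algebra_simps)
  qed
  ultimately show "(\<lambda>n. g (real n) powr x * (\<Prod>k=1..n. g (real k)) / (\<Prod>k=0..n. g (x + real k)))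
      \<longlonglongrightarrow> f x"
    by (simp add: tendsto_cong)
qed

end
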